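(* Let $G$ be a graph with $\gamma_{\rm R}(G)=2\beta(G)$, where $\beta(G)$ is the vertex covering number of $G$. Then: (1) $b_{\rm R}(G)\ge\delta(G)$; (2) $b_{\rm R}(G)\ge\delta(G)+1$ if $G$ is a vrc-graph.
   Context: Graphs are finite, undirected, without loops or multiple edges; a graph is nonempty if it has at least one edge; $\delta(G)$ is the minimum degree. The vertex covering number $\beta(G)$ is the minimum number of vertices that together are incident with all edges of $G$. A Roman dominating function on $G=(V,E)$ is a function $f:V\to\{0,1,2\}$ such that every vertex $x$ with $f(x)=0$ is adjacent to at least one vertex $y$ with $f(y)=2$. Its weight is $\sum_{u\in V}f(u)$. The Roman domination number $\gamma_{\rm R}(G)$ is the minimum weight of a Roman dominating function on $G$. A graph $G$ of order $n$ is vertex Roman domination-critical (a vrc-graph) if $\gamma_{\rm R}(G)\ne n$ and $\gamma_{\rm R}(G-x)<\gamma_{\rm R}(G)$ for every vertex $x$ of $G$. The Roman bondage number of a nonempty graph $G$ is $b_{\rm R}(G)=\min\{|B|: B\subseteq E(G),\ \gamma_{\rm R}(G-B)>\gamma_{\rm R}(G)\}$, with $b_{\rm R}(G)=\infty$ if no such $B$ exists; here $G-B$ is obtained from $G$ by deleting the edges in $B$ (keeping all vertices). *)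

theory Defs
  imports Main "HOL-Library.Extended_Nat"
begin

text \<open>
  A finite simple undirected graph is given by its vertex set \<open>V\<close> and its set \<open>E\<close> of edges,
  an edge being a two-element subset of \<open>V\<close>. The graph without vertices is admitted here, so that
  deleting a vertex always yields a graph.
\<close>

definition simple_graph :: "'a set \<Rightarrow> 'a set set \<Rightarrow> bool" where
  "simple_graph V E \<longleftrightarrow> finite V \<and> (\<forall>e\<in>E. e \<subseteq> V \<and> card e = 2)"

definition degree :: "'a set set \<Rightarrow> 'a \<Rightarrow> nat" where
  "degree E x = card {e \<in> E. x \<in> e}"

text \<open>Unspecified when \<open>V = {}\<close>.\<close>

definition min_degree :: "'a set \<Rightarrow> 'a set set \<Rightarrow> nat" where
  "min_degree V E = Min (degree E ` V)"

definition vertex_cover :: "'a set \<Rightarrow> 'a set set \<Rightarrow> 'a set \<Rightarrow> bool" where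
  "vertex_cover V E S \<longleftrightarrow> S \<subseteq> V \<and> (\<forall>e\<in>E. \<exists>x\<in>S. x \<in> e)"

definition vertex_covering_number :: "'a set \<Rightarrow> 'a set set \<Rightarrow> nat" where
  "vertex_covering_number V E = (LEAST k. \<exists>S. vertex_cover V E S \<and> card S = k)"

text \<open>Values of \<open>f\<close> outside \<open>V\<close> are irrelevant.\<close>

definition roman_dominating :: "'a set \<Rightarrow> 'a set set \<Rightarrow> ('a \<Rightarrow> nat) \<Rightarrow> bool" where
  "roman_dominating V E f \<longleftrightarrow>
     (\<forall>x\<in>V. f x \<in> {0, 1, 2}) \<and>
     (\<forall>x\<in>V. f x = 0 \<longrightarrow> (\<exists>y\<in>V. {x, y} \<in> E \<and> f y = 2))"

definition roman_domination_number :: "'a set \<Rightarrow> 'a set set \<Rightarrow> nat" where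
  "roman_domination_number V E =
     (LEAST w. \<exists>f. roman_dominating V E f \<and> (\<Sum>u\<in>V. f u) = w)"

definition vrc_graph :: "'a set \<Rightarrow> 'a set set \<Rightarrow> bool" where
  "vrc_graph V E \<longleftrightarrow>
     roman_domination_number V E \<noteq> card V \<and>
     (\<forall>x\<in>V. roman_domination_number (V - {x}) {e \<in> E. x \<notin> e} < roman_domination_number V E)"

text \<open>The infimum of the empty set in \<^typ>\<open>enat\<close> is \<open>\<infinity>\<close>, the value required if no suitable \<open>B\<close> exists.\<close>

definition roman_bondage_number :: "'a set \<Rightarrow> 'a set set \<Rightarrow> enat" where
  "roman_bondage_number V E =
     Inf {enat (card B) | B. B \<subseteq> E \<and>
            roman_domination_number V (E - B) > roman_domination_number V E}"

end

theory Submission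
  imports Defs
begin

text \<open>
  Giving every vertex of a vertex cover \<open>S\<close> the value 2 and all others the value 0 is a Roman
  dominating function as soon as no vertex is isolated: a neighbour of a vertex outside \<open>S\<close> must lie
  in \<open>S\<close>. A cover of \<open>G\<close> still covers \<open>G - B\<close>, so if \<open>\<gamma>\<^sub>R(G) = 2\<beta>(G)\<close>, the only way in which deleting
  \<open>B\<close> can raise the Roman domination number is by isolating some vertex \<open>x\<close>
  (lemma \<open>bondage_set_isolates\<close>). Then \<open>B\<close> contains all edges at \<open>x\<close>, of which there are at least
  \<open>\<delta>(G)\<close>; this is the first bound.

  If moreover \<open>|B| = \<delta>(G)\<close>, then \<open>B\<close> consists of exactly the edges at \<open>x\<close>, and \<open>G - B\<close> is \<open>G - x\<close> with
  one isolated vertex added. That vertex costs at most 1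
  (lemma \<open>roman_domination_number_add_vertex\<close>), and in a vrc-graph deleting \<open>x\<close> gains at least 1.
  Hence \<open>\<gamma>\<^sub>R(G - B) \<le> \<gamma>\<^sub>R(G - x) + 1 \<le> \<gamma>\<^sub>R(G)\<close>, so that \<open>B\<close> does not raise the number after all, and
  every \<open>B\<close> that does has more than \<open>\<delta>(G)\<close> edges.
\<close>

lemma roman_domination_number_le:
  assumes "roman_dominating V E f"
  shows "roman_domination_number V E \<le> (\<Sum>u\<in>V. f u)"
  unfolding roman_domination_number_def by (rule Least_le) (use assms in blast)

lemma roman_domination_number_attained:
  obtains f where "roman_dominating V E f" "(\<Sum>u\<in>V. f u) = roman_domination_number V E"
proof -
  have "roman_dominating V E (\<lambda>_. 1)"
    by (simp add: roman_dominating_def)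
  then have "\<exists>w f. roman_dominating V E f \<and> (\<Sum>u\<in>V. f u) = w"
    by blast
  from LeastI_ex[OF this] show thesis
    using that unfolding roman_domination_number_def by blast
qed

lemma vertex_covering_number_attained:
  assumes "simple_graph V E"
  obtains S where "vertex_cover V E S" "card S = vertex_covering_number V E"
proof -
  have "vertex_cover V E V"
    unfolding vertex_cover_def
  proof (intro conjI ballI subset_refl)
    fix e assume "e \<in> E"
    then have "e \<subseteq> V" "card e = 2"
      using assms by (auto simp: simple_graph_def)
    then show "\<exists>x\<in>V. x \<in> e"
      by (metis all_not_in_conv card.empty subsetD zero_neq_numeral)
  qed
  then have "\<exists>k S. vertex_cover V E S \<and> card S = k"
    by blast
  from LeastI_ex[OF this] show thesis
    using that unfolding vertex_covering_number_def by blast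
qed

lemma roman_domination_number_le_twice_cover:
  assumes "simple_graph V E" and "vertex_cover V E S"
    and no_isolated: "\<And>x. x \<in> V \<Longrightarrow> \<exists>e\<in>E. x \<in> e"
  shows "roman_domination_number V E \<le> 2 * card S"
proof -
  have "finite V" "S \<subseteq> V"
    using assms by (auto simp: simple_graph_def vertex_cover_def)
  define f where "f u = (if u \<in> S then 2 else 0 :: nat)" for u
  have dominated: "\<exists>y\<in>S. {x, y} \<in> E" if "x \<in> V" "x \<notin> S" for x
  proof -
    obtain e where e: "e \<in> E" "x \<in> e"
      using no_isolated \<open>x \<in> V\<close> by blast
    then obtain y where y: "y \<in> S" "y \<in> e"
      using assms(2) by (auto simp: vertex_cover_def)
    have "card e = 2"
      using e assms(1) by (auto simp: simple_graph_def)
    then have "e = {x, y}"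
      using e y \<open>x \<notin> S\<close> by (auto simp: card_2_iff)
    then show ?thesis
      using e y by blast
  qed
  have "roman_dominating V E f"
    unfolding roman_dominating_def
  proof (intro conjI ballI impI)
    fix x assume x: "x \<in> V"
    show "f x \<in> {0, 1, 2}"
      by (simp add: f_def)
    assume "f x = 0"
    then have "x \<notin> S"
      by (auto simp: f_def)
    then obtain y where "y \<in> S" "{x, y} \<in> E"
      using dominated x by blast
    then show "\<exists>y\<in>V. {x, y} \<in> E \<and> f y = 2"
      using \<open>S \<subseteq> V\<close> by (auto simp: f_def)
  qed
  moreover have "(\<Sum>u\<in>V. f u) = 2 * card S"
    using \<open>finite V\<close> \<open>S \<subseteq> V\<close>
    by (simp add: f_def sum.If_cases Int_absorb1)
  ultimately show ?thesis
    by (metis roman_domination_number_le)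
qed

text \<open>The added vertex can always be given the value 1, whatever its edges are.\<close>

lemma roman_domination_number_add_vertex:
  assumes "finite V" and "x \<in> V"
  shows "roman_domination_number V E \<le> roman_domination_number (V - {x}) E + 1"
proof -
  obtain f where f: "roman_dominating (V - {x}) E f"
      "(\<Sum>u\<in>V - {x}. f u) = roman_domination_number (V - {x}) E"
    by (rule roman_domination_number_attained)
  have "roman_dominating V E (f(x := 1))"
    unfolding roman_dominating_def
  proof (intro conjI ballI impI)
    fix u assume "u \<in> V"
    then show "(f(x := 1)) u \<in> {0, 1, 2}"
      using f(1) by (auto simp: roman_dominating_def)
    assume "(f(x := 1)) u = 0"
    then have "u \<noteq> x" "f u = 0"
      by (auto split: if_splits)
    then obtain y where "y \<in> V - {x}" "{u, y} \<in> E" "f y = 2"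
      using f(1) \<open>u \<in> V\<close> unfolding roman_dominating_def by blast
    then show "\<exists>y\<in>V. {u, y} \<in> E \<and> (f(x := 1)) y = 2"
      by auto
  qed
  then have "roman_domination_number V E \<le> (\<Sum>u\<in>V. (f(x := 1)) u)"
    by (rule roman_domination_number_le)
  also have "\<dots> = (\<Sum>u\<in>V - {x}. f u) + 1"
    using assms by (simp add: sum.remove)
  finally show ?thesis
    using f(2) by simp
qed

text \<open>
  If \<open>G - B\<close> had no isolated vertex, a minimum vertex cover of \<open>G\<close>, which also covers \<open>G - B\<close>, would
  give \<open>\<gamma>\<^sub>R(G - B) \<le> 2\<beta>(G) = \<gamma>\<^sub>R(G)\<close>.
\<close>

lemma bondage_set_isolates:
  assumes "simple_graph V E"
    and "roman_domination_number V E = 2 * vertex_covering_number V E"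
    and raises: "roman_domination_number V (E - B) > roman_domination_number V E"
  obtains x where "x \<in> V" "{e \<in> E. x \<in> e} \<subseteq> B"
proof (rule ccontr)
  assume "\<not> thesis"
  then have no_isolated: "\<exists>e\<in>E - B. x \<in> e" if "x \<in> V" for x
    using that \<open>\<And>x. x \<in> V \<Longrightarrow> {e \<in> E. x \<in> e} \<subseteq> B \<Longrightarrow> thesis\<close> by blast
  obtain S where S: "vertex_cover V E S" "card S = vertex_covering_number V E"
    using assms(1) by (rule vertex_covering_number_attained)
  have "simple_graph V (E - B)" "vertex_cover V (E - B) S"
    using assms(1) S(1) by (auto simp: simple_graph_def vertex_cover_def)
  then have "roman_domination_number V (E - B) \<le> 2 * card S"
    using no_isolated by (rule roman_domination_number_le_twice_cover)
  then show False
    using S(2) assms(2) raises by simp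
qed

theorem theorem5p10:
  fixes V :: "'a set" and E :: "'a set set"
  assumes "simple_graph V E"
    and "V \<noteq> {}"
    and "roman_domination_number V E = 2 * vertex_covering_number V E"
  shows "roman_bondage_number V E \<ge> enat (min_degree V E)
    \<and> (vrc_graph V E \<longrightarrow> roman_bondage_number V E \<ge> enat (min_degree V E + 1))"
proof -
  have "finite V"
    using assms(1) by (simp add: simple_graph_def)
  have "finite E"
    using assms(1) by (auto simp: simple_graph_def intro: finite_subset[of E "Pow V"])
  have min_degree_le: "min_degree V E \<le> degree E x" if "x \<in> V" for x
    using that \<open>finite V\<close> by (simp add: min_degree_def)
  have bounds: "min_degree V E \<le> card B \<and> (vrc_graph V E \<longrightarrow> min_degree V E + 1 \<le> card B)"
    if "B \<subseteq> E" and raises: "roman_domination_number V (E - B) > roman_domination_number V E" for B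
  proof -
    have "finite B"
      using \<open>B \<subseteq> E\<close> \<open>finite E\<close> by (rule finite_subset)
    obtain x where x: "x \<in> V" "{e \<in> E. x \<in> e} \<subseteq> B"
      using assms(1,3) raises by (rule bondage_set_isolates)
    have "degree E x \<le> card B"
      unfolding degree_def using \<open>finite B\<close> x(2) by (rule card_mono)
    then have le: "min_degree V E \<le> card B"
      using min_degree_le[OF x(1)] by simp
    have "card B \<noteq> min_degree V E" if "vrc_graph V E"
    proof
      assume "card B = min_degree V E"
      then have "card B \<le> card {e \<in> E. x \<in> e}"
        using min_degree_le[OF x(1)] by (simp add: degree_def)
      then have "{e \<in> E. x \<in> e} = B"
        using \<open>finite B\<close> x(2) by (intro card_seteq)
      then have "E - B = {e \<in> E. x \<notin> e}"
        by blast
      then have "roman_domination_number V (E - B)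
          \<le> roman_domination_number (V - {x}) {e \<in> E. x \<notin> e} + 1"
        using roman_domination_number_add_vertex[OF \<open>finite V\<close> x(1)] by simp
      also have "\<dots> \<le> roman_domination_number V E"
        using \<open>vrc_graph V E\<close> x(1) by (simp add: vrc_graph_def Suc_le_eq)
      finally show False
        using raises by simp
    qed
    with le show ?thesis
      by auto
  qed
  show ?thesis
    unfolding roman_bondage_number_def using bounds by (auto intro!: Inf_greatest)
qed

end
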